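(* Let $k\in\{0,1,2,\dots\}\cup\{\infty\}$. Then each of the classes $U_2(\mathbb{R},k)$, $U_3(\mathbb{R},k)$, $U_4(\mathbb{R},k)$, $U_5(\mathbb{R},k)$ is a dense $G_\delta$ subset of $C^k(\mathbb{R})$.
   Context: $C^k(\mathbb{R})$ is the space of $k$ times continuously differentiable $u:\mathbb{R}\to\mathbb{C}$, a Fréchet space with seminorms $\sup_{x\in[-n,n]}|u^{(l)}(x)|$, $n=1,2,\dots$, integers $0\le l\le k$. $D(z_0,r)$ is the open disk of center $z_0$, radius $r$. For $z_0\in\mathbb{R}$, $r>0$ let $\Omega(z_0,r)=D(z_0,r)\cap\{\operatorname{Im}z>0\}$, $P(z_0,r)=D(z_0,r)\cap\{\operatorname{Im}z<0\}$. $U_2(\mathbb{R},k)$: the $u\in C^k(\mathbb{R})$ for which there exist no $z_0\in\mathbb{R}$, $r>0$ and continuous $\lambda:\mathbb{R}\cup\Omega(z_0,r)\to\mathbb{C}$ holomorphic on $\Omega(z_0,r)$ with $\lambda=u$ on $D(z_0,r)\cap\mathbb{R}$. $U_3(\mathbb{R},k)$: the same with $P(z_0,r)$ instead of $\Omega(z_0,r)$. $U_4(\mathbb{R},k)=U_2(\mathbb{R},k)\cap U_3(\mathbb{R},k)$. $U_5(\mathbb{R},k)$: the $u\in C^k(\mathbb{R})$ for which there exist no $z_0\in\mathbb{R}$, $r>0$ and holomorphic $F:D(z_0,r)\to\mathbb{C}$ with $F=u$ on $D(z_0,r)\cap\mathbb{R}$. *)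

theory Defs
  imports "HOL-Analysis.Analysis" "HOL-Library.Extended_Nat"
begin

fun dder :: "nat \<Rightarrow> (real \<Rightarrow> complex) \<Rightarrow> real \<Rightarrow> complex" where
  "dder 0 u = u"
| "dder (Suc l) u = (\<lambda>x. vector_derivative (dder l u) (at x))"

definition Ck :: "enat \<Rightarrow> (real \<Rightarrow> complex) set" where
  "Ck k = {u. (\<forall>l. enat l < k \<longrightarrow> (\<forall>x. dder l u differentiable (at x)))
             \<and> (\<forall>l. enat l \<le> k \<longrightarrow> continuous_on UNIV (dder l u))}"

text \<open>Basic neighbourhoods for the Frechet topology given by the seminorms
  sup over [-n,n] of |u^(l)|, 0 <= l <= k: all seminorms with n <= N, l <= L
  (l <= k) are below eps.\<close>
definition Ck_nbhd :: "enat \<Rightarrow> (real \<Rightarrow> complex) \<Rightarrow> nat \<Rightarrow> nat \<Rightarrow> real \<Rightarrow> (real \<Rightarrow> complex) set" where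
  "Ck_nbhd k u N L \<epsilon> = {v \<in> Ck k. \<forall>l\<le>L. enat l \<le> k \<longrightarrow>
        (\<forall>x\<in>{-real N..real N}. norm (dder l v x - dder l u x) < \<epsilon>)}"

definition Ck_open :: "enat \<Rightarrow> (real \<Rightarrow> complex) set \<Rightarrow> bool" where
  "Ck_open k U \<longleftrightarrow> U \<subseteq> Ck k \<and>
     (\<forall>u\<in>U. \<exists>N L \<epsilon>. \<epsilon> > 0 \<and> Ck_nbhd k u N L \<epsilon> \<subseteq> U)"

lemma Ck_nbhd_mono:
  assumes "N \<le> N'" "L \<le> L'" "\<epsilon>' \<le> \<epsilon>"
  shows "Ck_nbhd k u N' L' \<epsilon>' \<subseteq> Ck_nbhd k u N L \<epsilon>"
proof
  fix v assume v: "v \<in> Ck_nbhd k u N' L' \<epsilon>'"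
  have "norm (dder l v x - dder l u x) < \<epsilon>"
    if "l \<le> L" "enat l \<le> k" "x \<in> {-real N..real N}" for l x
  proof -
    have "real N \<le> real N'" using assms(1) by simp
    then have "x \<in> {-real N'..real N'}" using that(3) by auto
    moreover have "l \<le> L'" using that(1) assms(2) by simp
    ultimately have "norm (dder l v x - dder l u x) < \<epsilon>'"
      using v that(2) unfolding Ck_nbhd_def by blast
    then show ?thesis using assms(3) by simp
  qed
  then show "v \<in> Ck_nbhd k u N L \<epsilon>" using v unfolding Ck_nbhd_def by blast
qed

lemma Ck_open_Int:
  assumes S: "Ck_open k S" and T: "Ck_open k T"
  shows "Ck_open k (S \<inter> T)"
  unfolding Ck_open_def
proof (intro conjI ballI)
  show "S \<inter> T \<subseteq> Ck k" using S unfolding Ck_open_def by blast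
next
  fix u assume u: "u \<in> S \<inter> T"
  obtain N1 L1 e1 where 1: "e1 > 0" "Ck_nbhd k u N1 L1 e1 \<subseteq> S"
    using S u unfolding Ck_open_def by blast
  obtain N2 L2 e2 where 2: "e2 > 0" "Ck_nbhd k u N2 L2 e2 \<subseteq> T"
    using T u unfolding Ck_open_def by blast
  have a: "Ck_nbhd k u (max N1 N2) (max L1 L2) (min e1 e2) \<subseteq> Ck_nbhd k u N1 L1 e1"
    by (rule Ck_nbhd_mono) simp_all
  have b: "Ck_nbhd k u (max N1 N2) (max L1 L2) (min e1 e2) \<subseteq> Ck_nbhd k u N2 L2 e2"
    by (rule Ck_nbhd_mono) simp_all
  have "min e1 e2 > 0" using 1(1) 2(1) by simp
  moreover have "Ck_nbhd k u (max N1 N2) (max L1 L2) (min e1 e2) \<subseteq> S \<inter> T"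
    using a b 1(2) 2(2) by blast
  ultimately show "\<exists>N L \<epsilon>. 0 < \<epsilon> \<and> Ck_nbhd k u N L \<epsilon> \<subseteq> S \<inter> T" by blast
qed

lemma Ck_open_Union:
  assumes "\<forall>S\<in>K. Ck_open k S"
  shows "Ck_open k (\<Union> K)"
  unfolding Ck_open_def
proof (intro conjI ballI)
  show "\<Union> K \<subseteq> Ck k" using assms unfolding Ck_open_def by blast
next
  fix u assume "u \<in> \<Union> K"
  then obtain S where S: "S \<in> K" "u \<in> S" by blast
  then obtain N L e where "e > 0" "Ck_nbhd k u N L e \<subseteq> S"
    using assms unfolding Ck_open_def by blast
  then show "\<exists>N L \<epsilon>. 0 < \<epsilon> \<and> Ck_nbhd k u N L \<epsilon> \<subseteq> \<Union> K" using S(1) by blast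
qed

lemma istopology_Ck_open: "istopology (Ck_open k)"
  unfolding istopology_def by (simp add: Ck_open_Int Ck_open_Union)

definition Ck_top :: "enat \<Rightarrow> (real \<Rightarrow> complex) topology" where
  "Ck_top k = topology (Ck_open k)"

lemma openin_Ck_top: "openin (Ck_top k) U \<longleftrightarrow> Ck_open k U"
  unfolding Ck_top_def by (simp add: topology_inverse'[OF istopology_Ck_open])

definition upper_half_disk :: "real \<Rightarrow> real \<Rightarrow> complex set" where
  "upper_half_disk x0 r = ball (complex_of_real x0) r \<inter> {z. Im z > 0}"

definition lower_half_disk :: "real \<Rightarrow> real \<Rightarrow> complex set" where
  "lower_half_disk x0 r = ball (complex_of_real x0) r \<inter> {z. Im z < 0}"

definition one_sided_ext :: "(real \<Rightarrow> complex) \<Rightarrow> real \<Rightarrow> real \<Rightarrow> complex set \<Rightarrow> bool" where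
  "one_sided_ext u x0 r H \<longleftrightarrow> (\<exists>lam :: complex \<Rightarrow> complex.
      continuous_on (\<real> \<union> H) lam \<and> lam holomorphic_on H \<and>
      (\<forall>z \<in> ball (complex_of_real x0) r \<inter> \<real>. lam z = u (Re z)))"

definition U2 :: "enat \<Rightarrow> (real \<Rightarrow> complex) set" where
  "U2 k = {u \<in> Ck k. \<not> (\<exists>x0 r. r > 0 \<and> one_sided_ext u x0 r (upper_half_disk x0 r))}"

definition U3 :: "enat \<Rightarrow> (real \<Rightarrow> complex) set" where
  "U3 k = {u \<in> Ck k. \<not> (\<exists>x0 r. r > 0 \<and> one_sided_ext u x0 r (lower_half_disk x0 r))}"

definition U4 :: "enat \<Rightarrow> (real \<Rightarrow> complex) set" where
  "U4 k = U2 k \<inter> U3 k"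

definition U5 :: "enat \<Rightarrow> (real \<Rightarrow> complex) set" where
  "U5 k = {u \<in> Ck k. \<not> (\<exists>x0 r (F :: complex \<Rightarrow> complex). r > 0 \<and>
      F holomorphic_on ball (complex_of_real x0) r \<and>
      (\<forall>z \<in> ball (complex_of_real x0) r \<inter> \<real>. F z = u (Re z)))}"

definition dense_gdelta_in :: "'a topology \<Rightarrow> 'a set \<Rightarrow> bool" where
  "dense_gdelta_in X S \<longleftrightarrow> gdelta_in X S \<and> X closure_of S = topspace X"

end

theory Submission
  imports Defs "HOL-Complex_Analysis.Complex_Analysis" "HOL-Real_Asymp.Real_Asymp"
begin

text \<open>
  A function with a one-sided extension somewhere has one over a rational half disk which is bounded
  there by an integer, so the complement of each class is a countable union of sets \<open>E\<close> given by
  a centre, a radius and a bound. By a two-constants estimate, a bounded sequence of holomorphic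
  functions on a half disk whose boundary values converge uniformly on the diameter converges
  uniformly on the concentric closed half disk of half the radius. Hence the closure of \<open>E\<close> still
  consists of extendable functions, and the classes are \<open>G\<^sub>\<delta>\<close>. For the two-sided class one uses that
  extensions from above and from below glue to a holomorphic function.

  Baire's theorem is not needed for density. The function \<open>w x = (\<Sum>n. 2 ^ (- n\<^sup>2) * cos (2 ^ n * x))\<close>
  is smooth, real valued and nowhere analytic, so by reflection it has no one-sided extension anywhere.
  If \<open>u + t w\<close> were extendable for all \<open>t\<close> in an interval, then for two distinct values of \<open>t\<close>
  it would extend to the same rational half disk, and so would \<open>w\<close>.
\<close>

subsection \<open>Extensions to half disks\<close>

text \<open>The sign \<open>s = 1\<close> or \<open>s = -1\<close> selects the upper or the lower half.\<close>

definition half_disk :: "real \<Rightarrow> real \<Rightarrow> real \<Rightarrow> complex set" where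
  "half_disk s x0 r = ball (of_real x0) r \<inter> {z. s * Im z > 0}"

definition closed_half_disk :: "real \<Rightarrow> real \<Rightarrow> real \<Rightarrow> complex set" where
  "closed_half_disk s x0 r = cball (of_real x0) r \<inter> {z. s * Im z \<ge> 0}"

text \<open>Unlike \<open>one_sided_ext\<close>, this asks for continuity only on the compact closed
  half disk, arc included, and carries an explicit bound \<open>M\<close>. The bound is what allows
  limits of extensions to be taken.\<close>

definition half_ext :: "real \<Rightarrow> real \<Rightarrow> (real \<Rightarrow> complex) \<Rightarrow> real \<Rightarrow> real \<Rightarrow> bool" where
  "half_ext s M u x0 r \<longleftrightarrow> (\<exists>f. continuous_on (closed_half_disk s x0 r) f \<and>
     f holomorphic_on half_disk s x0 r \<and> (\<forall>x\<in>{x0 - r..x0 + r}. f (of_real x) = u x) \<and>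
     (\<forall>z\<in>closed_half_disk s x0 r. norm (f z) \<le> M))"

lemma half_disk_unit:
  "upper_half_disk x0 r = half_disk 1 x0 r" "lower_half_disk x0 r = half_disk (-1) x0 r"
  by (auto simp: upper_half_disk_def lower_half_disk_def half_disk_def)

lemma open_half_disk: "open (half_disk s x0 r)"
  unfolding half_disk_def
  by (intro open_Int open_ball open_Collect_less continuous_intros)

lemma closed_closed_half_disk: "closed (closed_half_disk s x0 r)"
  unfolding closed_half_disk_def
  by (intro closed_Int closed_cball closed_Collect_le continuous_intros)

lemma compact_closed_half_disk: "compact (closed_half_disk s x0 r)"
  using closed_closed_half_disk[of s x0 r]
  by (metis bounded_Int bounded_cball closed_half_disk_def compact_eq_bounded_closed)

lemma half_disk_subset_closed: "half_disk s x0 r \<subseteq> closed_half_disk s x0 r"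
  by (auto simp: half_disk_def closed_half_disk_def)

lemma half_disk_mono:
  assumes "cball (of_real x1 :: complex) r1 \<subseteq> cball (of_real x0) r0"
  shows "half_disk s x1 r1 \<subseteq> half_disk s x0 r0"
    and "closed_half_disk s x1 r1 \<subseteq> closed_half_disk s x0 r0"
proof -
  have "interior (cball (of_real x1 :: complex) r1) \<subseteq> interior (cball (of_real x0) r0)"
    using assms by (rule interior_mono)
  then have "ball (of_real x1 :: complex) r1 \<subseteq> ball (of_real x0) r0" by simp
  then show "half_disk s x1 r1 \<subseteq> half_disk s x0 r0"
    unfolding half_disk_def by blast
  show "closed_half_disk s x1 r1 \<subseteq> closed_half_disk s x0 r0"
    using assms unfolding closed_half_disk_def by blast
qed

lemma of_real_mem_closed_half_disk [simp]:
  "of_real x \<in> closed_half_disk s x0 r \<longleftrightarrow> x \<in> {x0 - r..x0 + r}"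
  by (auto simp: closed_half_disk_def dist_of_real dist_real_def)

lemma half_ext_bound_mono: "half_ext s M u x0 r \<Longrightarrow> M \<le> M' \<Longrightarrow> half_ext s M' u x0 r"
  unfolding half_ext_def by (meson order_trans)

text \<open>Compactness of the closed half disk supplies the bound.\<close>

lemma half_extI:
  assumes "continuous_on (closed_half_disk s x0 r) f" "f holomorphic_on half_disk s x0 r"
    "\<And>x. x\<in>{x0 - r..x0 + r} \<Longrightarrow> f (of_real x) = u x"
  shows "\<exists>M. half_ext s M u x0 r"
proof -
  have "bounded (f ` closed_half_disk s x0 r)"
    by (intro compact_imp_bounded compact_continuous_image assms compact_closed_half_disk)
  then obtain M where "\<forall>z\<in>closed_half_disk s x0 r. norm (f z) \<le> M"
    unfolding bounded_iff by blast
  then show ?thesis unfolding half_ext_def using assms by blast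
qed

text \<open>The closed disk has to lie inside the open one because \<open>one_sided_ext\<close>
  gives no control near the outer arc.\<close>

lemma one_sided_ext_imp_half_ext:
  assumes "one_sided_ext u x0 r (half_disk s x0 r)" "s \<noteq> 0"
    "cball (of_real x1 :: complex) r1 \<subseteq> ball (of_real x0) r"
  shows "\<exists>M. half_ext s M u x1 r1"
proof -
  obtain f where f: "continuous_on (\<real> \<union> half_disk s x0 r) f" "f holomorphic_on half_disk s x0 r"
    "\<And>z. z \<in> ball (of_real x0) r \<inter> \<real> \<Longrightarrow> f z = u (Re z)"
    using assms(1) unfolding one_sided_ext_def by blast
  have "closed_half_disk s x1 r1 \<subseteq> \<real> \<union> half_disk s x0 r"
  proof
    fix z assume z: "z \<in> closed_half_disk s x1 r1"
    then have "z \<in> ball (of_real x0) r" using assms(3) by (auto simp: closed_half_disk_def)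
    moreover have "s * Im z > 0 \<or> Im z = 0"
      using z assms(2) by (auto simp: closed_half_disk_def less_le)
    ultimately show "z \<in> \<real> \<union> half_disk s x0 r"
      by (auto simp: half_disk_def complex_is_Real_iff)
  qed
  then have c: "continuous_on (closed_half_disk s x1 r1) f" using f(1) continuous_on_subset by blast
  have "half_disk s x1 r1 \<subseteq> half_disk s x0 r"
    by (rule half_disk_mono) (meson assms(3) ball_subset_cball order_trans)
  then have h: "f holomorphic_on half_disk s x1 r1" using f(2) holomorphic_on_subset by blast
  have "f (of_real x) = u x" if "x \<in> {x1 - r1..x1 + r1}" for x
  proof -
    have "(of_real x :: complex) \<in> cball (of_real x1) r1"
      using that by (auto simp: dist_of_real dist_real_def)
    from subsetD[OF assms(3) this] show ?thesis using f(3)[of "of_real x"] by auto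
  qed
  with c h show ?thesis by (rule half_extI)
qed

lemma half_ext_imp_one_sided_ext:
  assumes "half_ext s M u x0 r" "s \<noteq> 0" "continuous_on UNIV u"
  shows "one_sided_ext u x0 r (half_disk s x0 r)"
proof -
  obtain f where f: "continuous_on (closed_half_disk s x0 r) f" "f holomorphic_on half_disk s x0 r"
    "\<And>x. x\<in>{x0 - r..x0 + r} \<Longrightarrow> f (of_real x) = u x"
    using assms(1) unfolding half_ext_def by blast
  \<comment> \<open>\<open>one_sided_ext\<close> demands continuity on the whole real line, so
    \<open>u\<close> itself continues \<open>f\<close> along the reals outside the half disk; the
    two agree on the diameter.\<close>
  define g where "g z = (if z \<in> closed_half_disk s x0 r then f z else u (Re z))" for z
  have "continuous_on (closed_half_disk s x0 r \<union> \<real>) g"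
    unfolding g_def
  proof (intro continuous_on_cases closed_closed_half_disk closed_complex_Reals f(1) allI impI)
    show "continuous_on \<real> (\<lambda>z. u (Re z))"
      by (rule continuous_on_compose2[OF assms(3)]) (auto intro!: continuous_intros)
    fix z assume z: "z \<in> closed_half_disk s x0 r \<and> z \<notin> closed_half_disk s x0 r
          \<or> z \<in> \<real> \<and> z \<in> closed_half_disk s x0 r"
    then obtain x where "z = of_real x" by (auto elim: Reals_cases)
    then show "f z = u (Re z)" using z f(3)[of x] by auto
  qed
  then have "continuous_on (\<real> \<union> half_disk s x0 r) g"
    by (rule continuous_on_subset) (use half_disk_subset_closed in blast)
  moreover have "g holomorphic_on half_disk s x0 r"
    using f(2) by (rule holomorphic_transform) (use half_disk_subset_closed in \<open>auto simp: g_def\<close>)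
  moreover have "g z = u (Re z)" if "z \<in> ball (of_real x0) r \<inter> \<real>" for z
  proof -
    obtain x where "z = of_real x" using \<open>z \<in> _\<close> by (auto elim: Reals_cases)
    then show ?thesis using f(3)[of x] by (auto simp: g_def)
  qed
  ultimately show ?thesis unfolding one_sided_ext_def by blast
qed

section \<open>Reduction to countably many half disks and bounds\<close>

lemma rational_disk_inside:
  assumes "r > 0"
  obtains q n where "cball (complex_of_real (of_rat q)) (1 / real (Suc n)) \<subseteq> ball (of_real x0) r"
proof -
  obtain n where n: "1 / real (Suc n) < r / 2" using assms nat_approx_posE[of "r/2"] by auto
  obtain q where q: "x0 < of_rat q" "of_rat q < x0 + r / 2"
    using of_rat_dense[of x0 "x0 + r/2"] assms by auto
  have "cball (complex_of_real (of_rat q)) (1 / real (Suc n)) \<subseteq> ball (of_real x0) r"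
  proof
    fix z assume "z \<in> cball (complex_of_real (of_rat q)) (1 / real (Suc n))"
    then have "dist (of_real (of_rat q)) z < r / 2" using n by simp
    moreover have "dist (complex_of_real x0) (of_real (of_rat q)) < r / 2"
      using q by (simp only: dist_of_real) (simp add: dist_real_def)
    ultimately show "z \<in> ball (of_real x0) r"
      using dist_triangle[of "complex_of_real x0" z "of_real (of_rat q)"] by simp
  qed
  then show thesis by (rule that)
qed

text \<open>Shrinking to a rational half disk keeps an extension and makes it bounded, and enlarging
  the bound to a natural number is harmless. Conversely, a half disk with rational data is a half
  disk.\<close>

lemma one_sided_ext_iff_rational:
  assumes "continuous_on UNIV u" "s \<noteq> 0"
  shows "(\<exists>x0 r. r > 0 \<and> one_sided_ext u x0 r (half_disk s x0 r)) \<longleftrightarrow>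
    (\<exists>q n m. half_ext s (real m) u (of_rat q) (1 / real (Suc n)))"
proof
  assume "\<exists>x0 r. r > 0 \<and> one_sided_ext u x0 r (half_disk s x0 r)"
  then obtain x0 r where r: "r > 0" "one_sided_ext u x0 r (half_disk s x0 r)" by blast
  obtain q n where qn: "cball (complex_of_real (of_rat q)) (1 / real (Suc n)) \<subseteq> ball (of_real x0) r"
    using rational_disk_inside[OF r(1)] by blast
  obtain M where M: "half_ext s M u (of_rat q) (1 / real (Suc n))"
    using one_sided_ext_imp_half_ext[OF r(2) assms(2) qn] by blast
  obtain m where "M \<le> real m" using real_arch_simple by blast
  then have "half_ext s (real m) u (of_rat q) (1 / real (Suc n))"
    using M half_ext_bound_mono by blast
  then show "\<exists>q n m. half_ext s (real m) u (of_rat q) (1 / real (Suc n))" by blast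
next
  assume "\<exists>q n m. half_ext s (real m) u (of_rat q) (1 / real (Suc n))"
  then obtain q n m where "half_ext s (real m) u (of_rat q) (1 / real (Suc n))" by blast
  from half_ext_imp_one_sided_ext[OF this assms(2,1)]
  show "\<exists>x0 r. r > 0 \<and> one_sided_ext u x0 r (half_disk s x0 r)"
    by (intro exI[of _ "of_rat q"] exI[of _ "1 / real (Suc n)"]) simp
qed

section \<open>Restricting, gluing, subtracting and reflecting extensions\<close>

lemma holomorphic_ext_imp_half_ext:
  assumes "F holomorphic_on ball (of_real x0) r"
    "\<And>z. z \<in> ball (of_real x0) r \<inter> \<real> \<Longrightarrow> F z = u (Re z)"
    "cball (of_real x1 :: complex) r1 \<subseteq> ball (of_real x0) r"
  shows "\<exists>M. half_ext s M u x1 r1"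
proof (rule half_extI)
  show "continuous_on (closed_half_disk s x1 r1) F"
    by (rule continuous_on_subset[OF holomorphic_on_imp_continuous_on[OF assms(1)]])
       (use assms(3) in \<open>auto simp: closed_half_disk_def\<close>)
  show "F holomorphic_on half_disk s x1 r1"
    by (rule holomorphic_on_subset[OF assms(1)])
       (use assms(3) ball_subset_cball in \<open>fastforce simp: half_disk_def\<close>)
  show "F (of_real x) = u x" if "x \<in> {x1 - r1..x1 + r1}" for x
  proof -
    have "(of_real x :: complex) \<in> cball (of_real x1) r1"
      using that by (auto simp: dist_of_real dist_real_def)
    from subsetD[OF assms(3) this] show ?thesis using assms(2)[of "of_real x"] by auto
  qed
qed

text \<open>The two extensions agree with \<open>u\<close> on the diameter, so they paste to a
  continuous function; a continuous function that is holomorphic off a line is holomorphic across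
  it.\<close>

lemma half_ext_both_sides_imp_holomorphic_ext:
  assumes "half_ext 1 M u x0 r" "half_ext (-1) M' u x0 r"
  shows "\<exists>F. F holomorphic_on ball (of_real x0) r \<and>
    (\<forall>z \<in> ball (of_real x0) r \<inter> \<real>. F z = u (Re z))"
proof -
  obtain f where f: "continuous_on (closed_half_disk 1 x0 r) f" "f holomorphic_on half_disk 1 x0 r"
    "\<And>x. x\<in>{x0 - r..x0 + r} \<Longrightarrow> f (of_real x) = u x"
    using assms(1) unfolding half_ext_def by blast
  obtain g where g: "continuous_on (closed_half_disk (-1) x0 r) g" "g holomorphic_on half_disk (-1) x0 r"
    "\<And>x. x\<in>{x0 - r..x0 + r} \<Longrightarrow> g (of_real x) = u x"
    using assms(2) unfolding half_ext_def by blast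
  define F where "F z = (if z \<in> closed_half_disk 1 x0 r then f z else g z)" for z
  have "continuous_on (closed_half_disk 1 x0 r \<union> closed_half_disk (-1) x0 r) F"
    unfolding F_def
  proof (intro continuous_on_cases closed_closed_half_disk f(1) g(1) allI impI)
    fix z assume z: "z \<in> closed_half_disk 1 x0 r \<and> z \<notin> closed_half_disk 1 x0 r
          \<or> z \<in> closed_half_disk (-1) x0 r \<and> z \<in> closed_half_disk 1 x0 r"
    then have "z = of_real (Re z)" by (auto simp: closed_half_disk_def complex_eq_iff)
    then show "f z = g z" using z f(3)[of "Re z"] g(3)[of "Re z"]
      by (metis of_real_mem_closed_half_disk)
  qed
  then have "continuous_on (ball (of_real x0) r) F"
    by (rule continuous_on_subset) (auto simp: closed_half_disk_def)
  \<comment> \<open>\<open>\<i> \<bullet> z\<close> is \<open>Im z\<close>; the pasting theorem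
    describes the line by a normal vector, here \<open>\<i>\<close>.\<close>
  moreover have "F holomorphic_on ball (of_real x0) r \<inter> {z. \<i> \<bullet> z < 0}"
  proof -
    have "ball (of_real x0) r \<inter> {z. \<i> \<bullet> z < 0} = half_disk (-1) x0 r"
      by (auto simp: half_disk_def inner_complex_def)
    moreover have "F holomorphic_on half_disk (-1) x0 r"
      using g(2) by (rule holomorphic_transform)
        (auto simp: F_def closed_half_disk_def half_disk_def)
    ultimately show ?thesis by simp
  qed
  moreover have "F holomorphic_on ball (of_real x0) r \<inter> {z. 0 < \<i> \<bullet> z}"
  proof -
    have "ball (of_real x0) r \<inter> {z. 0 < \<i> \<bullet> z} = half_disk 1 x0 r"
      by (auto simp: half_disk_def inner_complex_def)
    moreover have "F holomorphic_on half_disk 1 x0 r"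
      using f(2) by (rule holomorphic_transform)
        (auto simp: F_def closed_half_disk_def half_disk_def)
    ultimately show ?thesis by simp
  qed
  ultimately have "F holomorphic_on ball (of_real x0) r"
    using holomorphic_on_paste_across_line[of "ball (of_real x0) r" \<i> F 0] by simp
  moreover have "F z = u (Re z)" if "z \<in> ball (of_real x0) r \<inter> \<real>" for z
  proof -
    obtain x where x: "z = of_real x" using \<open>z \<in> _\<close> by (auto elim: Reals_cases)
    then have "z \<in> closed_half_disk 1 x0 r" using that by (auto simp: closed_half_disk_def)
    then show ?thesis using x f(3)[of x] by (auto simp: F_def)
  qed
  ultimately show ?thesis by blast
qed

text \<open>The factor \<open>c\<close> serves to recover \<open>w\<close> from two perturbations
  \<open>u + t w\<close> and \<open>u + t' w\<close> that extend to the same half disk.\<close>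

lemma half_ext_diff:
  assumes "half_ext s M u x0 r" "half_ext s M' v x0 r"
  shows "\<exists>M. half_ext s M (\<lambda>x. c * (u x - v x)) x0 r"
proof -
  obtain f where f: "continuous_on (closed_half_disk s x0 r) f" "f holomorphic_on half_disk s x0 r"
    "\<And>x. x\<in>{x0 - r..x0 + r} \<Longrightarrow> f (of_real x) = u x"
    using assms(1) unfolding half_ext_def by blast
  obtain g where g: "continuous_on (closed_half_disk s x0 r) g" "g holomorphic_on half_disk s x0 r"
    "\<And>x. x\<in>{x0 - r..x0 + r} \<Longrightarrow> g (of_real x) = v x"
    using assms(2) unfolding half_ext_def by blast
  show ?thesis
    by (rule half_extI[of _ _ _ "\<lambda>z. c * (f z - g z)"])
       (use f g in \<open>auto intro!: continuous_intros holomorphic_intros\<close>)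
qed

text \<open>Schwarz reflection: conjugating both argument and value moves \<open>f\<close> to the
  other half, and real boundary values are unchanged.\<close>

lemma half_ext_reflect:
  assumes "half_ext s M u x0 r" "\<And>x. u x \<in> \<real>"
  shows "half_ext (-s) M u x0 r"
proof -
  obtain f where f: "continuous_on (closed_half_disk s x0 r) f" "f holomorphic_on half_disk s x0 r"
    "\<And>x. x\<in>{x0 - r..x0 + r} \<Longrightarrow> f (of_real x) = u x"
    "\<And>z. z\<in>closed_half_disk s x0 r \<Longrightarrow> norm (f z) \<le> M"
    using assms(1) unfolding half_ext_def by blast
  have d: "dist (complex_of_real x0) (cnj z) = dist (complex_of_real x0) z" for z
    using complex_mod_cnj[of "of_real x0 - z"] by (simp add: dist_norm)
  have cd: "cnj ` closed_half_disk (-s) x0 r = closed_half_disk s x0 r"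
   and od: "cnj ` half_disk (-s) x0 r = half_disk s x0 r"
    by (auto simp: closed_half_disk_def half_disk_def d image_iff intro!: bexI[of _ "cnj _"])
  have "continuous_on (closed_half_disk (-s) x0 r) (cnj \<circ> f \<circ> cnj)"
    by (intro continuous_on_compose) (auto simp: cd intro!: continuous_intros f(1))
  moreover have "(cnj \<circ> f \<circ> cnj) holomorphic_on half_disk (-s) x0 r"
    by (subst holomorphic_on_compose_cnj_cnj) (auto simp: od open_half_disk f(2))
  moreover have "(cnj \<circ> f \<circ> cnj) (of_real x) = u x" if "x \<in> {x0 - r..x0 + r}" for x
    using f(3)[OF that] assms(2)[of x] by (simp add: Reals_cnj_iff)
  moreover have "norm ((cnj \<circ> f \<circ> cnj) z) \<le> M" if "z \<in> closed_half_disk (-s) x0 r" for z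
    using f(4)[of "cnj z"] cd that by auto
  ultimately show ?thesis unfolding half_ext_def by blast
qed

subsection \<open>Limits of bounded extensions\<close>

text \<open>The pole \<open>x0 - s * \<i> * r\<close> lies on the bounding circle, opposite the half
  disk. A Moebius map sends a circle through its pole to a line, so the harmonic function
  \<open>h\<close> is constant on that circle. The gap between \<open>1 / (2 * r)\<close> on the arc
  and \<open>2 / (3 * r)\<close> on the smaller half disk is what the two-constants estimate
  exploits.\<close>

lemma half_disk_barrier:
  assumes s: "s * s = 1" and r: "r > 0" and z: "z \<in> closed_half_disk s x0 r"
  defines "h \<equiv> Re (of_real s * \<i> / (z - of_real x0 + of_real s * \<i> * of_real r))"
  shows "z - of_real x0 + of_real s * \<i> * of_real r \<noteq> 0"
    and "h \<le> 1 / r"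
    and "dist (of_real x0) z = r \<Longrightarrow> h = 1 / (2 * r)"
    and "dist (of_real x0) z \<le> r / 2 \<Longrightarrow> h \<ge> 2 / (3 * r)"
proof -
  define x where "x = Re z - x0"
  define y where "y = s * Im z"
  \<comment> \<open>The squared modulus of the denominator in \<open>h\<close>, in coordinates
    centred at \<open>x0\<close> and flipped so that the half disk lies in
    \<open>y \<ge> 0\<close>.\<close>
  define D where "D = x\<^sup>2 + y\<^sup>2 + 2 * r * y + r\<^sup>2"
  have y: "y \<ge> 0" using z by (auto simp: closed_half_disk_def y_def)
  have yy: "y\<^sup>2 = (Im z)\<^sup>2" using s by (simp add: y_def power2_eq_square algebra_simps)
  have Imz: "Im z = s * y" using s by (simp add: y_def)
  have dd: "(dist (of_real x0) z)\<^sup>2 = x\<^sup>2 + y\<^sup>2"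
    unfolding dist_norm cmod_power2 yy by (simp add: x_def power2_commute)
  have Dpos: "D > 0" using r y by (auto simp: D_def intro!: add_nonneg_pos)
  have nw: "(x)\<^sup>2 + (Im z + s * r)\<^sup>2 = D"
  proof -
    have "(Im z + s * r)\<^sup>2 = (s * s) * (y + r)\<^sup>2" by (simp add: Imz power2_eq_square algebra_simps)
    then show ?thesis using s by (simp add: D_def power2_eq_square algebra_simps)
  qed
  show "z - of_real x0 + of_real s * \<i> * of_real r \<noteq> 0"
  proof
    assume "z - of_real x0 + of_real s * \<i> * of_real r = 0"
    then have "x = 0" "Im z + s * r = 0" by (auto simp: complex_eq_iff x_def)
    then show False using nw Dpos by simp
  qed
  have h: "h = (y + r) / D"
  proof -
    have "h = s * (Im z + s * r) / (x\<^sup>2 + (Im z + s * r)\<^sup>2)"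
      by (simp add: h_def Re_divide x_def)
    also have "s * (Im z + s * r) = y + r" using s by (simp add: y_def algebra_simps)
    finally show ?thesis using nw by simp
  qed
  have "(y + r) * r \<le> D" using y r by (simp add: D_def power2_eq_square algebra_simps)
  then show "h \<le> 1 / r" using Dpos r by (simp add: h divide_simps)
  show "h = 1 / (2 * r)" if "dist (of_real x0) z = r"
  proof -
    have "D = 2 * r * (y + r)" using dd that by (simp add: D_def power2_eq_square algebra_simps)
    then show ?thesis using h y r by simp
  qed
  show "h \<ge> 2 / (3 * r)" if "dist (of_real x0) z \<le> r / 2"
  proof -
    have "(dist (of_real x0) z)\<^sup>2 \<le> (r / 2)\<^sup>2" using that r by (intro power_mono) auto
    then have a: "x\<^sup>2 + y\<^sup>2 \<le> r\<^sup>2 / 4" using dd by (simp add: power_divide)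
    moreover have "(r / 2)\<^sup>2 = r\<^sup>2 / 4" by (simp add: power_divide)
    ultimately have "y\<^sup>2 \<le> (r / 2)\<^sup>2" using zero_le_power2[of x] by linarith
    then have "y \<le> r / 2" by (rule power2_le_imp_le) (use r in simp)
    then have "r * y \<le> r * (r/2)" using r by (intro mult_left_mono) auto
    then have "2 * D \<le> 3 * r * (y + r)" using a by (simp add: D_def power2_eq_square algebra_simps)
    then show ?thesis using Dpos r by (simp add: h divide_simps algebra_simps)
  qed
qed

text \<open>For \<open>s = 1\<close>: multiplying by \<open>exp (6rK i / (z - x0 + ir))\<close>, whose modulus is constant on the bounding
  semicircle and larger inside, trades the bound on the semicircle against the bound on the
  diameter.\<close>

lemma half_disk_two_constants:
  assumes s: "s * s = 1" and r: "r > 0" and K: "K \<ge> 0" and e: "e \<ge> 0"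
    and cont: "continuous_on (closed_half_disk s x0 r) f"
    and hol: "f holomorphic_on half_disk s x0 r"
    and M: "\<And>z. z \<in> closed_half_disk s x0 r \<Longrightarrow> norm (f z) \<le> M"
    and seg: "\<And>x. x \<in> {x0 - r..x0 + r} \<Longrightarrow> norm (f (of_real x)) \<le> e"
    and z: "z \<in> closed_half_disk s x0 (r / 2)"
  shows "norm (f z) \<le> max (e * exp (2 * K)) (M * exp (- K))"
proof -
  define w where "w z = z - of_real x0 + of_real s * \<i> * of_real r" for z :: complex
  define h where "h z = Re (of_real s * \<i> / w z)" for z
  \<comment> \<open>With the factor \<open>6 * r * K\<close> the exponent
    \<open>6 * r * K * h\<close> equals \<open>3 * K\<close> on the arc, is at most
    \<open>6 * K\<close> on the diameter and at least \<open>4 * K\<close> on the half disk of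
    radius \<open>r / 2\<close>. Dividing by \<open>exp (4 * K)\<close> leaves the factors
    \<open>exp (2 * K)\<close> and \<open>exp (- K)\<close>.\<close>
  define g where "g z = f z * exp (of_real (6 * r * K) * (of_real s * \<i> / w z))" for z
  define B where "B = max (e * exp (6 * K)) (M * exp (3 * K))"
  note bar = half_disk_barrier[OF s r, where ?x0.0=x0, folded w_def, folded h_def]
  have normg: "norm (g z) = norm (f z) * exp (6 * r * K * h z)" for z
    unfolding g_def h_def norm_mult norm_exp_eq_Re
    by (simp only: times_complex.sel Re_complex_of_real Im_complex_of_real mult_zero_left diff_zero)
  have zin: "z \<in> closed_half_disk s x0 r"
    using z r by (auto simp: closed_half_disk_def)
  have real: "y \<in> half_disk s x0 r \<or> dist (of_real x0) y = r \<or>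
     (\<exists>x \<in> {x0 - r..x0 + r}. y = of_real x)"
    if "y \<in> closed_half_disk s x0 r" for y
  proof (cases "Im y = 0")
    case True
    then have "y = of_real (Re y)" by (simp add: complex_eq_iff)
    then show ?thesis using that by (metis of_real_mem_closed_half_disk)
  next
    case False
    then show ?thesis using that s
      by (auto simp: closed_half_disk_def half_disk_def less_le)
  qed
  have M0: "M \<ge> 0" using M[OF zin] norm_ge_zero order_trans by blast
  have bd: "norm (g y) \<le> B"
    if y: "y \<in> closed_half_disk s x0 r" "y \<notin> half_disk s x0 r" for y
    using real[OF y(1)] y(2)
  proof (elim disjE bexE)
    assume "dist (of_real x0) y = r"
    then have "6 * r * K * h y = 3 * K" using bar(3)[OF y(1)] r by simp
    then have "norm (g y) \<le> M * exp (3 * K)" using M[OF y(1)] unfolding normg by (simp only:) simp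
    then show ?thesis by (simp add: B_def)
  next
    fix x assume x: "x \<in> {x0 - r..x0 + r}" "y = of_real x"
    have "r * h y \<le> 1" using bar(2)[OF y(1)] r by (simp add: field_simps)
    then have "K * (r * h y) \<le> K * 1" using K by (intro mult_left_mono) auto
    then have "exp (6 * r * K * h y) \<le> exp (6 * K)" by (simp add: algebra_simps)
    then have "norm (g y) \<le> e * exp (6 * K)"
      unfolding normg using seg[OF x(1)] x(2) e by (intro mult_mono) auto
    then show ?thesis by (simp add: B_def)
  qed simp
  have gB: "norm (g z) \<le> B"
  proof (cases "z \<in> half_disk s x0 r")
    case True
    have cl: "closure (half_disk s x0 r) \<subseteq> closed_half_disk s x0 r"
      by (simp add: closure_minimal half_disk_subset_closed closed_closed_half_disk)
    have nz: "w y \<noteq> 0" if "y \<in> closed_half_disk s x0 r" for y using bar(1)[OF that] .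
    show ?thesis
    proof (rule maximum_modulus_frontier[OF _ _ _ _ True])
      have "g holomorphic_on half_disk s x0 r" unfolding g_def w_def
        using nz[unfolded w_def] half_disk_subset_closed[of s x0 r] by (intro holomorphic_intros hol) auto
      then show "g holomorphic_on interior (half_disk s x0 r)"
        by (simp add: open_half_disk interior_open)
      have "continuous_on (closed_half_disk s x0 r) g" unfolding g_def w_def
        using nz[unfolded w_def] by (intro continuous_intros cont) auto
      then show "continuous_on (closure (half_disk s x0 r)) g"
        using cl continuous_on_subset by blast
      show "bounded (half_disk s x0 r)" by (simp add: half_disk_def bounded_Int)
      fix y assume "y \<in> frontier (half_disk s x0 r)"
      then show "norm (g y) \<le> B" using cl bd[of y]
        by (auto simp: frontier_def interior_open open_half_disk)
    qed
  next
    \<comment> \<open>A point of the diameter is not in the open half disk; there the boundary bound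
      applies directly.\<close>
    case False
    then show ?thesis using bd zin by blast
  qed
  have "2 \<le> 3 * r * h z"
    using bar(4)[OF zin] z r by (simp add: closed_half_disk_def field_simps)
  then have "K * 2 \<le> K * (3 * r * h z)" using K by (intro mult_left_mono) auto
  then have "exp (4 * K) \<le> exp (6 * r * K * h z)" by (simp add: algebra_simps)
  then have "norm (f z) * exp (4 * K) \<le> norm (g z)"
    unfolding normg by (intro mult_left_mono) auto
  also note gB
  finally have "norm (f z) \<le> B * exp (- (4 * K))" by (simp add: exp_minus field_simps)
  also have "B * exp (- (4 * K)) = max (e * exp (2 * K)) (M * exp (- K))"
    by (simp add: B_def max_mult_distrib_right mult.assoc flip: exp_add)
  finally show ?thesis .
qed

text \<open>Differences of the approximating extensions are bounded by \<open>2 * M\<close> and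
  small on the diameter, so the two-constants estimate makes the extensions uniformly Cauchy, up to
  and including the diameter, on the half disk of half the radius. Their limit extends
  \<open>u\<close>.\<close>

lemma half_ext_closed:
  assumes s: "s * s = 1" and r: "r > 0"
    and approx: "\<And>e. e > 0 \<Longrightarrow> \<exists>v. half_ext s M v x0 r \<and> (\<forall>x\<in>{x0 - r..x0 + r}. norm (v x - u x) < e)"
  shows "\<exists>M. half_ext s M u x0 (r / 2)"
proof -
  have "\<forall>n. \<exists>v. half_ext s M v x0 r \<and> (\<forall>x\<in>{x0 - r..x0 + r}. norm (v x - u x) < 1 / real (Suc n))"
    using approx by simp
  then obtain v where v: "\<And>n. half_ext s M (v n) x0 r"
    "\<And>n x. x\<in>{x0 - r..x0 + r} \<Longrightarrow> norm (v n x - u x) < 1 / real (Suc n)" by metis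
  then have "\<forall>n. \<exists>f. continuous_on (closed_half_disk s x0 r) f \<and>
     f holomorphic_on half_disk s x0 r \<and> (\<forall>x\<in>{x0 - r..x0 + r}. f (of_real x) = v n x) \<and>
     (\<forall>z\<in>closed_half_disk s x0 r. norm (f z) \<le> M)" unfolding half_ext_def by blast
  then obtain f where f: "\<And>n. continuous_on (closed_half_disk s x0 r) (f n)"
    "\<And>n. f n holomorphic_on half_disk s x0 r"
    "\<And>n x. x\<in>{x0 - r..x0 + r} \<Longrightarrow> f n (of_real x) = v n x"
    "\<And>n z. z\<in>closed_half_disk s x0 r \<Longrightarrow> norm (f n z) \<le> M" by metis
  have sub: "closed_half_disk s x0 (r/2) \<subseteq> closed_half_disk s x0 r" "half_disk s x0 (r/2) \<subseteq> half_disk s x0 r"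
    using r by (auto simp: closed_half_disk_def half_disk_def)
  have "uniformly_Cauchy_on (closed_half_disk s x0 (r/2)) f"
  proof (rule uniformly_Cauchy_onI)
    fix d :: real assume d: "d > 0"
    \<comment> \<open>Order of choice: \<open>K\<close> first makes the interior term
      \<open>2 * M * exp (- K)\<close> small; then \<open>N\<close>, depending on \<open>K\<close>,
      makes the boundary error beat \<open>exp (2 * K)\<close>.\<close>
    have "((\<lambda>K::real. 2 * M * exp (- K)) \<longlongrightarrow> 0) at_top" by real_asymp
    then have "\<forall>\<^sub>F K in at_top. 2 * M * exp (- K) < d" using d by (rule order_tendstoD)
    then obtain K0 where "\<forall>K\<ge>K0. 2 * M * exp (- K) < d" unfolding eventually_at_top_linorder by blast
    then obtain K where K: "K \<ge> 0" "2 * M * exp (- K) < d" by (meson max.cobounded1 max.cobounded2)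
    have "d * exp (- (2 * K)) / 2 > 0" using d by simp
    then obtain N where N: "1 / real (Suc N) < d * exp (- (2 * K)) / 2" using nat_approx_posE by blast
    have "dist (f m z) (f n z) < d"
      if z: "z \<in> closed_half_disk s x0 (r/2)" and mn: "m \<ge> N" "n \<ge> N" for z m n
    proof -
      define e where "e = 2 / real (Suc N)"
      have "norm (f m z - f n z) \<le> max (e * exp (2 * K)) (2 * M * exp (- K))"
      proof (rule half_disk_two_constants[OF s r K(1), where f="\<lambda>z. f m z - f n z"])
        show "e \<ge> 0" by (simp add: e_def)
        show "continuous_on (closed_half_disk s x0 r) (\<lambda>z. f m z - f n z)"
          by (intro continuous_intros f)
        show "(\<lambda>z. f m z - f n z) holomorphic_on half_disk s x0 r"
          by (intro holomorphic_intros f)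
        show "norm (f m z - f n z) \<le> 2 * M" if "z \<in> closed_half_disk s x0 r" for z
          using f(4)[OF that, of m] f(4)[OF that, of n] norm_triangle_ineq4[of "f m z" "f n z"] by simp
        show "z \<in> closed_half_disk s x0 (r/2)" by fact
        show "norm (f m (of_real x) - f n (of_real x)) \<le> e" if x: "x \<in> {x0 - r..x0 + r}" for x
        proof -
          have "norm (v m x - v n x) \<le> norm (v m x - u x) + norm (v n x - u x)"
            by (metis norm_triangle_ineq4 diff_diff_eq2 diff_add_cancel)
          also have "\<dots> \<le> 1 / real (Suc m) + 1 / real (Suc n)"
            using v(2)[OF x, of m] v(2)[OF x, of n] by simp
          also have "\<dots> \<le> 1 / real (Suc N) + 1 / real (Suc N)"
            using mn by (intro add_mono divide_left_mono) auto
          finally show ?thesis using f(3)[OF x] by (simp add: e_def)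
        qed
      qed
      also have "\<dots> < d"
      proof -
        have "e * exp (2 * K) < d * exp (- (2 * K)) * exp (2 * K)"
          using N by (intro mult_strict_right_mono) (auto simp: e_def)
        also have "\<dots> = d" by (simp add: exp_minus)
        finally show ?thesis using K(2) by simp
      qed
      finally show ?thesis by (simp add: dist_norm)
    qed
    then show "\<exists>N. \<forall>z\<in>closed_half_disk s x0 (r/2). \<forall>m\<ge>N. \<forall>n\<ge>N. dist (f m z) (f n z) < d" by blast
  qed
  then obtain g where g: "uniform_limit (closed_half_disk s x0 (r/2)) f g sequentially"
    unfolding uniformly_convergent_eq_Cauchy[symmetric] uniformly_convergent_on_def by blast
  have "continuous_on (closed_half_disk s x0 (r/2)) g"
    by (rule uniform_limit_theorem[OF _ g])
       (auto intro!: always_eventually continuous_on_subset[OF f(1) sub(1)])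
  moreover have "g holomorphic_on half_disk s x0 (r/2)"
  proof (rule holomorphic_uniform_sequence[OF open_half_disk])
    show "f n holomorphic_on half_disk s x0 (r/2)" for n
      using f(2) sub(2) holomorphic_on_subset by blast
    fix z assume "z \<in> half_disk s x0 (r/2)"
    then obtain d where d: "d > 0" "cball z d \<subseteq> half_disk s x0 (r/2)"
      using open_half_disk open_contains_cball by metis
    then have "cball z d \<subseteq> closed_half_disk s x0 (r/2)" using half_disk_subset_closed by blast
    with d g show "\<exists>d. 0 < d \<and> cball z d \<subseteq> half_disk s x0 (r/2) \<and> uniform_limit (cball z d) f g sequentially"
      using uniform_limit_on_subset by blast
  qed
  moreover have "g (of_real x) = u x" if "x \<in> {x0 - r/2..x0 + r/2}" for x
  proof -
    have "(\<lambda>n. f n (of_real x)) \<longlonglongrightarrow> g (of_real x)"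
      using g that by (intro tendsto_uniform_limitI) auto
    moreover have x: "x \<in> {x0 - r..x0 + r}" using that r by auto
    moreover have "v n x = f n (of_real x)" for n using f(3)[OF x] by simp
    moreover have "(\<lambda>n. v n x) \<longlonglongrightarrow> u x"
    proof (rule LIM_zero_cancel, rule Lim_null_comparison)
      show "\<forall>\<^sub>F n in sequentially. norm (v n x - u x) \<le> 1 / real (Suc n)"
        using v(2)[OF x] by (auto intro!: always_eventually less_imp_le)
      show "(\<lambda>n. 1 / real (Suc n)) \<longlonglongrightarrow> 0" by real_asymp
    qed
    ultimately show ?thesis using LIMSEQ_unique by simp
  qed
  ultimately show ?thesis by (rule half_extI)
qed

subsection \<open>A smooth nowhere analytic function\<close>

text \<open>The \<open>l\<close>-th termwise derivative of the series for \<open>w\<close>: each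
  differentiation brings out \<open>2 ^ n\<close> and shifts the phase by \<open>pi / 2\<close>. The
  quadratic exponent makes all these series converge, yet their values grow too fast with
  \<open>l\<close> for analyticity.\<close>

definition lacunary :: "nat \<Rightarrow> real \<Rightarrow> real" where
  "lacunary l x = (\<Sum>n. 2 ^ (n * l) / 2 ^ (n\<^sup>2) * cos (2 ^ n * x + real l * (pi / 2)))"

text \<open>For \<open>n > l\<close> the exponent \<open>n * l - n\<^sup>2\<close> is at most
  \<open>- n\<close>, so a geometric series dominates eventually.\<close>

lemma summable_lacunary_coeff: "summable (\<lambda>n. 2 ^ (n * l) / 2 ^ (n\<^sup>2) :: real)"
proof (rule summable_comparison_test_ev)
  show "\<forall>\<^sub>F n in sequentially. norm (2 ^ (n * l) / 2 ^ (n\<^sup>2) :: real) \<le> (1 / 2) ^ n"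
    using eventually_ge_at_top[of "Suc l"]
  proof eventually_elim
    case (elim n)
    have "n * l + n \<le> n\<^sup>2" using mult_le_mono2[OF elim, of n] by (simp add: power2_eq_square)
    then have "(2::real) ^ (n * l + n) \<le> 2 ^ (n\<^sup>2)" by (intro power_increasing) auto
    then show ?case by (simp add: power_add field_simps)
  qed
qed (simp add: summable_geometric)

lemma summable_lacunary:
  "summable (\<lambda>n. 2 ^ (n * l) / 2 ^ (n\<^sup>2) * cos (2 ^ n * x + real l * (pi / 2)))"
  by (rule summable_comparison_test[OF _ summable_lacunary_coeff[of l]])
     (auto simp: abs_mult intro!: divide_right_mono)

text \<open>Termwise differentiation: by the Weierstrass test the differentiated series converges
  uniformly on the whole line.\<close>

lemma DERIV_lacunary: "(lacunary l has_field_derivative lacunary (Suc l) x) (at x)"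
proof -
  let ?f = "\<lambda>l n x. 2 ^ (n * l) / 2 ^ (n\<^sup>2) * cos (2 ^ n * x + real l * (pi / 2)) :: real"
  have "((\<lambda>x. \<Sum>n. ?f l n x) has_field_derivative (\<Sum>n. ?f (Suc l) n x)) (at x)"
  proof (rule has_field_derivative_series'(2)[where S=UNIV and ?x0.0=x])
    fix n and x :: real
    have "cos (2 ^ n * x + real (Suc l) * (pi / 2)) = - sin (2 ^ n * x + real l * (pi / 2))"
      using minus_sin_cos_eq[of "2 ^ n * x + real l * (pi / 2)"] by (simp add: algebra_simps add_divide_distrib)
    then have "?f (Suc l) n x = 2 ^ (n * l) / 2 ^ (n\<^sup>2) * (- sin (2 ^ n * x + real l * (pi / 2)) * 2 ^ n)"
      by (simp add: power_add)
    then show "(?f l n has_field_derivative ?f (Suc l) n x) (at x within UNIV)"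
      by (auto intro!: derivative_eq_intros)
  next
    show "uniformly_convergent_on UNIV (\<lambda>n x. \<Sum>i<n. ?f (Suc l) i x)"
      by (rule Weierstrass_m_test'[OF _ summable_lacunary_coeff[of "Suc l"]])
         (auto simp: abs_mult intro!: divide_right_mono)
  qed (use summable_lacunary[of l x] in \<open>simp_all only: UNIV_I interior_UNIV convex_UNIV\<close>)
  then show ?thesis unfolding lacunary_def[abs_def] .
qed

lemma has_vector_derivative_lacunary:
  "((\<lambda>x. of_real (lacunary l x) :: complex) has_vector_derivative of_real (lacunary (Suc l) x)) (at x)"
  using DERIV_lacunary[of l x]
  by (intro has_vector_derivative_of_real) (simp add: has_real_derivative_iff_has_vector_derivative)

lemma dder_lacunary: "dder l (\<lambda>x. of_real (lacunary 0 x)) = (\<lambda>x. of_real (lacunary l x))"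
proof (induction l)
  case (Suc l)
  have "vector_derivative (\<lambda>x. of_real (lacunary l x) :: complex) (at x) = of_real (lacunary (Suc l) x)" for x
    by (rule vector_derivative_at[OF has_vector_derivative_lacunary])
  then show ?case using Suc by simp
qed simp

lemma lacunary_in_Ck: "(\<lambda>x. of_real (lacunary 0 x)) \<in> Ck k"
  unfolding Ck_def mem_Collect_eq dder_lacunary
  by (intro conjI allI impI continuous_at_imp_continuous_on ballI
        differentiableI_vector[OF has_vector_derivative_lacunary]
        has_vector_derivative_continuous[OF has_vector_derivative_lacunary])

section \<open>Failure of analyticity by Cauchy estimates\<close>

lemma dder_eq_higher_deriv:
  assumes "F holomorphic_on S" "open S" "\<And>x. of_real x \<in> S \<Longrightarrow> F (of_real x) = u x"
    "of_real x \<in> S"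
  shows "dder l u x = (deriv ^^ l) F (of_real x)"
  using assms(4)
proof (induction l arbitrary: x)
  case (Suc l)
  let ?G = "(deriv ^^ l) F"
  have "?G holomorphic_on S" using assms(1,2) by (rule holomorphic_higher_deriv)
  then have "(?G has_field_derivative deriv ?G (of_real x)) (at (of_real x))"
    using holomorphic_derivI[OF _ assms(2) Suc.prems] by blast
  then have v: "((\<lambda>x. ?G (of_real x)) has_vector_derivative deriv ?G (of_real x)) (at x)"
    by (rule has_vector_derivative_real_field)
  \<comment> \<open>The induction hypothesis holds at all real points of \<open>S\<close>, hence on
    a real neighbourhood of \<open>x\<close>, so it may be differentiated.\<close>
  have "open (of_real -` S :: real set)" using assms(2) by (intro open_vimage continuous_intros)
  then have "(dder l u has_vector_derivative deriv ?G (of_real x)) (at x)"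
    by (rule has_vector_derivative_transform_within_open[OF v]) (use Suc in auto)
  then show ?case by (simp add: vector_derivative_at)
qed (use assms in auto)

text \<open>The points are the multiples of \<open>2 * pi / 2 ^ m\<close>: for
  \<open>n \<ge> m\<close>, multiplication by \<open>2 ^ n\<close> turns them into integer multiples
  of \<open>2 * pi\<close>. A large \<open>m\<close> makes the grid finer than
  \<open>r\<close>.\<close>

lemma dyadic_pi_dense:
  fixes r x0 :: real
  assumes "r > 0"
  obtains x1 m where "\<bar>x1 - x0\<bar> < r" "\<And>n. n \<ge> m \<Longrightarrow> cos (2 ^ n * x1) = 1"
proof -
  obtain m where m: "2 * pi / r < 2 ^ m" using real_arch_pow[of 2 "2 * pi / r"] by auto
  define d where "d = 2 * pi / 2 ^ m"
  have d: "d > 0" "d < r" using m assms by (auto simp: d_def field_simps)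
  define j where "j = \<lfloor>x0 / d\<rfloor>"
  show thesis
  proof
    have "real_of_int j \<le> x0 / d" "x0 / d < real_of_int j + 1" unfolding j_def by linarith+
    then have "of_int j * d \<le> x0" "x0 < of_int j * d + d" using d by (auto simp: field_simps)
    then show "\<bar>of_int j * d - x0\<bar> < r" using d by linarith
    fix n assume "n \<ge> m"
    then obtain i where "n = m + i" using le_Suc_ex by blast
    then have "2 ^ n * (of_int j * d) = 2 * pi * of_int (j * 2 ^ i)"
      by (simp add: d_def power_add)
    then show "cos (2 ^ n * (of_int j * d)) = 1" by (metis cos_int_2pin)
  qed
qed

text \<open>At a dyadic multiple of \<open>2\<pi>\<close> all but finitely many cosines equal 1, and the term \<open>n = 2p\<close>
  alone already outgrows the Cauchy estimates.\<close>

lemma lacunary_lower_bound: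
  assumes "\<And>n. n \<ge> m \<Longrightarrow> cos (2 ^ n * x) = 1" "2 * p \<ge> m"
  shows "lacunary (4 * p) x \<ge> 2 ^ ((2 * p)\<^sup>2) - real m * 2 ^ (m * (4 * p))"
proof -
  define f where "f n = 2 ^ (n * (4 * p)) / 2 ^ (n\<^sup>2) * cos (2 ^ n * x + real (4 * p) * (pi / 2))" for n :: nat
  \<comment> \<open>Orders divisible by 4 shift the phase by full periods, so the cosines remain
    those of the hypothesis.\<close>
  have "real (4 * p) * (pi / 2) = 2 * pi * of_int (int p)" by simp
  then have cosf: "cos (2 ^ n * x + real (4 * p) * (pi / 2)) = cos (2 ^ n * x)" for n :: nat
    by (simp only: cos_add cos_int_2pin sin_int_2pin mult_1_right mult_zero_right diff_zero)
  have sf: "summable f" unfolding f_def by (rule summable_lacunary)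
  have pos: "f n \<ge> 0" if "n \<ge> m" for n unfolding f_def cosf using assms(1)[OF that] by simp
  \<comment> \<open>Terms from \<open>m\<close> on are nonnegative, so all of them except
    \<open>n = 2 * p\<close> may be dropped.\<close>
  have "(\<Sum>n\<in>{..<m} \<union> {2 * p}. f n) \<le> suminf f"
    by (rule sum_le_suminf[OF sf]) (use pos in auto)
  also have "(\<Sum>n\<in>{..<m} \<union> {2 * p}. f n) = (\<Sum>n<m. f n) + f (2 * p)"
    using assms(2) by (subst sum.union_disjoint) auto
  finally have 1: "(\<Sum>n<m. f n) + f (2 * p) \<le> lacunary (4 * p) x"
    by (simp add: lacunary_def f_def)
  \<comment> \<open>For \<open>l = 4 * p\<close> the exponent \<open>n * l - n\<^sup>2\<close> is
    largest at \<open>n = 2 * p\<close>, with value \<open>(2 * p)\<^sup>2\<close>.\<close>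
  have "2 * p * (4 * p) = (2 * p)\<^sup>2 + (2 * p)\<^sup>2" by (simp add: power2_eq_square)
  then have 2: "f (2 * p) = 2 ^ ((2 * p)\<^sup>2)"
    unfolding f_def cosf using assms by (simp only: power_add) simp
  have "- (2 ^ (m * (4 * p))) \<le> f n" if "n < m" for n
  proof -
    have "\<bar>f n\<bar> \<le> 2 ^ (n * (4 * p)) / 2 ^ (n\<^sup>2) * 1"
      unfolding f_def abs_mult by (intro mult_mono) auto
    also have "\<dots> \<le> 2 ^ (n * (4 * p))" by (simp add: divide_le_eq_1 field_simps)
    also have "\<dots> \<le> 2 ^ (m * (4 * p))" using that by (intro power_increasing) auto
    finally show ?thesis by linarith
  qed
  then have "(\<Sum>n<m. - (2 ^ (m * (4 * p)))) \<le> (\<Sum>n<m. f n)" by (intro sum_mono) auto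
  then show ?thesis using 1 2 by simp
qed

text \<open>The right side is \<open>(2 ^ p) ^ (4 * p)\<close>, whereas the factorial term is at
  most \<open>B * (4 * p / r) ^ (4 * p)\<close> and the other term is
  \<open>m * (2 ^ m) ^ (4 * p)\<close>; the base \<open>2 ^ p\<close> outgrows both bases.\<close>

lemma gaussian_beats_factorial:
  fixes B r :: real and m :: nat
  assumes "r > 0" "B > 0"
  shows "\<forall>\<^sub>F p in sequentially.
    fact (4 * p) * B / r ^ (4 * p) + real m * 2 ^ (m * (4 * p)) < 2 ^ ((2 * p)\<^sup>2)"
proof -
  have "\<forall>\<^sub>F p::nat in sequentially. 4 * real p / r \<le> 2 ^ p / 2" using assms by real_asymp
  moreover have "\<forall>\<^sub>F p::nat in sequentially. B + real m < 2 ^ (4 * p)" by real_asymp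
  ultimately show ?thesis using eventually_ge_at_top[of "Suc m"]
  proof eventually_elim
    case (elim p)
    \<comment> \<open>Halving the base holds a factor \<open>2 ^ (4 * p)\<close> in reserve to
      absorb the constant \<open>B + m\<close>.\<close>
    define A :: real where "A = (2 ^ p / 2) ^ (4 * p)"
    have A: "A > 0" by (simp add: A_def)
    have A2: "A * 2 ^ (4 * p) = 2 ^ ((2 * p)\<^sup>2)"
      unfolding A_def power_mult_distrib[symmetric]
      by (simp add: power2_eq_square mult_ac flip: power_mult)
    have "fact (4 * p) \<le> real (4 * p) ^ (4 * p)" using fact_le_power[of "4 * p", where 'a=real] by simp
    then have "fact (4 * p) * B / r ^ (4 * p) \<le> real (4 * p) ^ (4 * p) * B / r ^ (4 * p)"
      using assms by (intro divide_right_mono mult_right_mono) auto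
    also have "\<dots> = B * (4 * real p / r) ^ (4 * p)" by (simp add: power_divide)
    also have "\<dots> \<le> B * A" unfolding A_def using elim assms by (intro mult_left_mono power_mono) auto
    finally have 1: "fact (4 * p) * B / r ^ (4 * p) \<le> B * A" .
    have "(2::real) ^ (Suc m) \<le> 2 ^ p" using elim by (intro power_increasing) auto
    then have "((2::real) ^ m) ^ (4 * p) \<le> A" unfolding A_def by (intro power_mono) auto
    then have "real m * 2 ^ (m * (4 * p)) \<le> real m * A"
      by (intro mult_left_mono) (auto simp: power_mult)
    with 1 have "fact (4 * p) * B / r ^ (4 * p) + real m * 2 ^ (m * (4 * p)) \<le> A * (B + real m)"
      by (simp add: algebra_simps)
    also have "\<dots> < A * 2 ^ (4 * p)" using elim A by (intro mult_strict_left_mono) auto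
    finally show ?case using A2 by simp
  qed
qed

text \<open>At a dyadic multiple of \<open>2 * pi\<close> inside the disk, the Cauchy estimates for
  the derivatives of order \<open>4 * p\<close> contradict the lower bound for large
  \<open>p\<close>.\<close>

lemma lacunary_no_holomorphic_ext:
  assumes "r > 0" "F holomorphic_on ball (of_real x0) r"
  shows "\<exists>z\<in>ball (of_real x0) r \<inter> \<real>. F z \<noteq> of_real (lacunary 0 (Re z))"
proof (rule ccontr)
  assume "\<not> ?thesis"
  then have F: "F z = of_real (lacunary 0 (Re z))" if "z \<in> ball (of_real x0) r \<inter> \<real>" for z
    using that by blast
  obtain x1 m where x1: "\<bar>x1 - x0\<bar> < r" "\<And>n. n \<ge> m \<Longrightarrow> cos (2 ^ n * x1) = 1"
    using dyadic_pi_dense[OF assms(1)] by blast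
  have x1in: "complex_of_real x1 \<in> ball (of_real x0) r"
    using x1(1) by (simp add: dist_of_real dist_real_def abs_minus_commute)
  then obtain d where d: "d > 0" "cball (of_real x1) d \<subseteq> ball (complex_of_real x0) r"
    using open_contains_cball open_ball by metis
  have cont: "continuous_on (cball (of_real x1) d) F"
    using assms(2) d(2) holomorphic_on_imp_continuous_on continuous_on_subset by blast
  have hol: "F holomorphic_on ball (of_real x1) d"
    using assms(2) d(2) ball_subset_cball by (meson holomorphic_on_subset order_trans)
  have "bounded (F ` cball (of_real x1) d)"
    by (intro compact_imp_bounded compact_continuous_image cont compact_cball)
  then obtain B where B: "B > 0" "\<And>z. z \<in> cball (of_real x1) d \<Longrightarrow> norm (F z) \<le> B"
    unfolding bounded_pos by blast
  obtain P where P: "\<And>p. p \<ge> P \<Longrightarrow> fact (4 * p) * B / d ^ (4 * p) + real m * 2 ^ (m * (4 * p)) < 2 ^ ((2 * p)\<^sup>2)"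
    using gaussian_beats_factorial[OF d(1) B(1)] unfolding eventually_sequentially by blast
  \<comment> \<open>\<open>P\<close> secures the growth comparison, and \<open>m\<close> ensures
    that the dominant index \<open>2 * p\<close> is at least \<open>m\<close>.\<close>
  define p where "p = max P m"
  have "norm ((deriv ^^ (4 * p)) F (of_real x1)) \<le> fact (4 * p) * B / d ^ (4 * p)"
    by (rule Cauchy_inequality[OF hol cont d(1)]) (use B in \<open>auto simp: dist_norm\<close>)
  moreover have "(deriv ^^ (4 * p)) F (of_real x1) = of_real (lacunary (4 * p) x1)"
    using dder_eq_higher_deriv[OF assms(2) open_ball _ x1in, of "\<lambda>x. of_real (lacunary 0 x)" "4 * p"] F
    by (simp add: dder_lacunary)
  moreover have "lacunary (4 * p) x1 \<ge> 2 ^ ((2 * p)\<^sup>2) - real m * 2 ^ (m * (4 * p))"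
    by (rule lacunary_lower_bound) (use x1 in \<open>auto simp: p_def\<close>)
  moreover have "fact (4 * p) * B / d ^ (4 * p) + real m * 2 ^ (m * (4 * p)) < 2 ^ ((2 * p)\<^sup>2)"
    by (rule P) (simp add: p_def)
  ultimately show False by (simp only: norm_of_real)
qed

subsection \<open>Topology of the classes\<close>

lemma topspace_Ck_top: "topspace (Ck_top k) = Ck k"
proof
  show "topspace (Ck_top k) \<subseteq> Ck k"
    using openin_topspace[of "Ck_top k"] unfolding openin_Ck_top Ck_open_def by blast
  have "Ck_open k (Ck k)" by (auto simp: Ck_open_def Ck_nbhd_def intro!: exI[of _ 1])
  then show "Ck k \<subseteq> topspace (Ck_top k)" by (simp add: openin_Ck_top openin_subset)
qed

lemma Ck_imp_continuous: "u \<in> Ck k \<Longrightarrow> continuous_on UNIV u"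
  unfolding Ck_def by (auto dest: spec[of _ 0] simp flip: zero_enat_def)

text \<open>The complement in \<open>Ck k\<close> of the closure of \<open>S\<close>, expressed
  through basic neighbourhoods.\<close>

definition Ck_exterior :: "enat \<Rightarrow> (real \<Rightarrow> complex) set \<Rightarrow> (real \<Rightarrow> complex) set" where
  "Ck_exterior k S = {u \<in> Ck k. \<exists>N L \<epsilon>. \<epsilon> > 0 \<and> Ck_nbhd k u N L \<epsilon> \<inter> S = {}}"

lemma openin_Ck_exterior: "openin (Ck_top k) (Ck_exterior k S)"
  unfolding openin_Ck_top Ck_open_def
proof (intro conjI ballI)
  fix u assume "u \<in> Ck_exterior k S"
  then obtain N L e where e: "u \<in> Ck k" "e > 0" "Ck_nbhd k u N L e \<inter> S = {}"
    unfolding Ck_exterior_def by blast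
  have "v \<in> Ck_exterior k S" if v: "v \<in> Ck_nbhd k u N L (e/2)" for v
  proof -
    have "Ck_nbhd k v N L (e/2) \<subseteq> Ck_nbhd k u N L e"
    proof
      fix w assume w: "w \<in> Ck_nbhd k v N L (e/2)"
      have "norm (dder l w x - dder l u x) < e"
        if "l \<le> L" "enat l \<le> k" "x \<in> {- real N..real N}" for l x
      proof (rule norm_triangle_half_r)
        show "norm (dder l v x - dder l w x) < e / 2"
          using w that by (auto simp: Ck_nbhd_def norm_minus_commute)
        show "norm (dder l v x - dder l u x) < e / 2"
          using v that by (auto simp: Ck_nbhd_def)
      qed
      then show "w \<in> Ck_nbhd k u N L e" using w by (auto simp: Ck_nbhd_def)
    qed
    then have "Ck_nbhd k v N L (e/2) \<inter> S = {}" using e by blast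
    moreover have "v \<in> Ck k" using v by (simp add: Ck_nbhd_def)
    ultimately show ?thesis unfolding Ck_exterior_def using e(2) half_gt_zero by blast
  qed
  then show "\<exists>N L \<epsilon>. 0 < \<epsilon> \<and> Ck_nbhd k u N L \<epsilon> \<subseteq> Ck_exterior k S"
    using half_gt_zero[OF e(2)] by blast
qed (simp add: Ck_exterior_def)

lemma Ck_exterior_disjoint: "Ck_exterior k S \<inter> S = {}"
proof -
  have "u \<in> Ck_nbhd k u N L e" if "u \<in> Ck k" "e > 0" for u N L e
    using that by (simp add: Ck_nbhd_def)
  then show ?thesis unfolding Ck_exterior_def by blast
qed

text \<open>Taking the exterior instead of the complement makes openness automatic. Limits of
  extendable functions are controlled only on half the radius, but this loss is invisible once all
  half disks are considered.\<close>

definition non_ext :: "enat \<Rightarrow> real \<Rightarrow> rat \<times> nat \<times> nat \<Rightarrow> (real \<Rightarrow> complex) set" where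
  "non_ext k s = (\<lambda>(q, n, m). Ck_exterior k {v \<in> Ck k. half_ext s (real m) v (of_rat q) (1 / real (Suc n))})"

lemma openin_non_ext: "openin (Ck_top k) (non_ext k s i)"
  by (cases i) (simp add: non_ext_def openin_Ck_exterior)

lemma non_ext_subset_Ck: "non_ext k s i \<subseteq> Ck k"
  using openin_subset[OF openin_non_ext] by (simp add: topspace_Ck_top)

lemma not_half_ext_non_ext:
  assumes "u \<in> non_ext k s (q, n, m)"
  shows "\<not> half_ext s (real m) u (of_rat q) (1 / real (Suc n))"
proof -
  have "u \<in> Ck k" using assms non_ext_subset_Ck by blast
  then show ?thesis using assms Ck_exterior_disjoint unfolding non_ext_def by blast
qed

lemma half_ext_if_not_non_ext:
  assumes "u \<in> Ck k" "u \<notin> non_ext k s (q, n, m)" "s * s = 1"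
  shows "\<exists>M. half_ext s M u (of_rat q) (1 / real (Suc n) / 2)"
proof (rule half_ext_closed[OF assms(3)])
  let ?r = "1 / real (Suc n)"
  fix e :: real assume "e > 0"
  obtain N :: nat where N: "\<bar>of_rat q\<bar> + ?r \<le> real N" using real_arch_simple by blast
  \<comment> \<open>Only uniform closeness on an interval containing the diameter is used, hence
    order \<open>0\<close>.\<close>
  obtain v where v: "v \<in> Ck_nbhd k u N 0 e" "half_ext s (real m) v (of_rat q) ?r"
    using assms(1,2) \<open>e > 0\<close> unfolding non_ext_def Ck_exterior_def by fastforce
  have "norm (v x - u x) < e" if "x \<in> {of_rat q - ?r..of_rat q + ?r}" for x
  proof -
    have "x \<in> {- real N..real N}" using that N unfolding atLeastAtMost_iff by linarith
    then show ?thesis using v(1) by (auto simp: Ck_nbhd_def zero_enat_def[symmetric])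
  qed
  then show "\<exists>v. half_ext s (real m) v (of_rat q) ?r \<and>
      (\<forall>x\<in>{of_rat q - ?r..of_rat q + ?r}. norm (v x - u x) < e)" using v(2) by blast
qed simp

text \<open>A function outside some \<open>non_ext k s i\<close> extends to a half disk of half the
  radius, which already contradicts having no extension. Conversely, a function in all of them has
  no bounded extension to any rational half disk, which excludes every one-sided extension.\<close>

lemma no_one_sided_ext_eq_Inter_non_ext:
  assumes "s * s = 1"
  shows "{u \<in> Ck k. \<not> (\<exists>x0 r. r > 0 \<and> one_sided_ext u x0 r (half_disk s x0 r))} = \<Inter> (range (non_ext k s))"
    (is "{u \<in> Ck k. \<not> ?E u} = _")
proof (intro equalityI subsetI INT_I CollectI conjI)
  have s: "s \<noteq> 0" using assms by auto
  {
    fix u and i :: "rat \<times> nat \<times> nat" assume "u \<in> {u \<in> Ck k. \<not> ?E u}"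
    then have u: "u \<in> Ck k" "\<not> ?E u" by simp_all
    obtain q n m where i: "i = (q, n, m)" by (cases i) auto
    show "u \<in> non_ext k s i"
    proof (rule ccontr)
      assume "u \<notin> non_ext k s i"
      then obtain M where "half_ext s M u (of_rat q) (1 / real (Suc n) / 2)"
        using half_ext_if_not_non_ext[OF u(1) _ assms] i by blast
      from half_ext_imp_one_sided_ext[OF this s Ck_imp_continuous[OF u(1)]]
      have "?E u" by (intro exI conjI) simp_all
      then show False using u(2) by blast
    qed
  next
    fix u assume u: "u \<in> \<Inter> (range (non_ext k s))"
    show C: "u \<in> Ck k" by (rule subsetD[OF non_ext_subset_Ck InterD[OF u rangeI]])
    have "\<not> half_ext s (real m) u (of_rat q) (1 / real (Suc n))" for q n m
      by (rule not_half_ext_non_ext[OF InterD[OF u rangeI]])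
    then show "\<not> ?E u"
      unfolding one_sided_ext_iff_rational[OF Ck_imp_continuous[OF C] s] by blast
  }
qed

lemma U2_eq: "U2 k = \<Inter> (range (non_ext k 1))"
  using no_one_sided_ext_eq_Inter_non_ext[of 1 k] by (simp add: U2_def half_disk_unit)

lemma U3_eq: "U3 k = \<Inter> (range (non_ext k (-1)))"
  using no_one_sided_ext_eq_Inter_non_ext[of "-1" k] by (simp add: U3_def half_disk_unit)

text \<open>A holomorphic extension amounts to extensions from both sides, so non-extendability
  asks, at each index, for failure on at least one side.\<close>

lemma U5_eq: "U5 k = (\<Inter>i. non_ext k 1 i \<union> non_ext k (-1) i)"
proof (intro equalityI subsetI INT_I)
  fix u and i :: "rat \<times> nat \<times> nat" assume u: "u \<in> U5 k"
  obtain q n m where i: "i = (q, n, m)" by (cases i) auto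
  show "u \<in> non_ext k 1 i \<union> non_ext k (-1) i"
  proof (rule ccontr)
    assume "\<not> ?thesis"
    moreover have "u \<in> Ck k" using u by (simp add: U5_def)
    ultimately obtain M M' where "half_ext 1 M u (of_rat q) (1 / real (Suc n) / 2)"
       "half_ext (-1) M' u (of_rat q) (1 / real (Suc n) / 2)"
      using half_ext_if_not_non_ext[of u k 1 q n m] half_ext_if_not_non_ext[of u k "-1" q n m] i by auto
    from half_ext_both_sides_imp_holomorphic_ext[OF this]
    obtain F where F: "F holomorphic_on ball (complex_of_real (of_rat q)) (1 / real (Suc n) / 2)"
      "\<forall>z\<in>ball (complex_of_real (of_rat q)) (1 / real (Suc n) / 2) \<inter> \<real>. F z = u (Re z)" by blast
    moreover have "1 / real (Suc n) / 2 > 0" by simp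
    ultimately show False using u unfolding U5_def by blast
  qed
next
  fix u assume u: "u \<in> (\<Inter>i. non_ext k 1 i \<union> non_ext k (-1) i)"
  have "u \<in> Ck k" using u non_ext_subset_Ck by blast
  moreover have False
    if r: "r > 0" and F: "F holomorphic_on ball (of_real x0) r"
      "\<And>z. z \<in> ball (of_real x0) r \<inter> \<real> \<Longrightarrow> F z = u (Re z)" for x0 r F
  proof -
    obtain q n where qn: "cball (complex_of_real (of_rat q)) (1 / real (Suc n)) \<subseteq> ball (of_real x0) r"
      using rational_disk_inside[OF r] by blast
    obtain M1 M2 where M: "half_ext 1 M1 u (of_rat q) (1 / real (Suc n))"
        "half_ext (-1) M2 u (of_rat q) (1 / real (Suc n))"
      using holomorphic_ext_imp_half_ext[OF F qn] by blast
    \<comment> \<open>One bound for both sides, so that both memberships fail at the same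
      index.\<close>
    obtain m :: nat where m: "max M1 M2 \<le> real m" using real_arch_simple by blast
    then have "half_ext 1 (real m) u (of_rat q) (1 / real (Suc n))"
      "half_ext (-1) (real m) u (of_rat q) (1 / real (Suc n))"
      using M half_ext_bound_mono by auto
    moreover have "u \<in> non_ext k 1 (q, n, m) \<union> non_ext k (-1) (q, n, m)" using u by (rule INT_D) simp
    ultimately show False using not_half_ext_non_ext[of u k _ q n m] by auto
  qed
  ultimately show "u \<in> U5 k" unfolding U5_def by blast
qed

lemma gdelta_in_INT_openin:
  fixes A :: "'i::countable \<Rightarrow> 'a set"
  assumes "\<And>i. openin X (A i)"
  shows "gdelta_in X (\<Inter> (range A))"
proof (rule gdelta_in_Inter)
  show "countable (range A)" by (rule countableI_type[THEN countable_image])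
  show "range A \<noteq> {}" by blast
  fix S assume "S \<in> range A"
  then obtain i where "S = A i" by (rule rangeE)
  then show "gdelta_in X S" using open_imp_gdelta_in[OF assms] by metis
qed

section \<open>Density by perturbation along the lacunary function\<close>

lemma dder_add_mult:
  assumes "u \<in> Ck k" "v \<in> Ck k" "enat l \<le> k"
  shows "dder l (\<lambda>x. u x + c * v x) = (\<lambda>x. dder l u x + c * dder l v x)"
  using assms(3)
proof (induction l)
  case (Suc l)
  \<comment> \<open>\<open>vector_derivative\<close> is determined only where a derivative exists;
    \<open>l < k\<close> provides differentiability of both functions.\<close>
  then have l: "enat l < k" by (simp add: Suc_ile_eq)
  have "(dder l u has_vector_derivative dder (Suc l) u x) (at x)"
       "(dder l v has_vector_derivative dder (Suc l) v x) (at x)" for x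
    using assms(1,2) l by (simp_all add: Ck_def vector_derivative_works)
  then have "((\<lambda>x. dder l u x + c * dder l v x) has_vector_derivative
      (dder (Suc l) u x + c * dder (Suc l) v x)) (at x)" for x
    by (intro has_vector_derivative_add has_vector_derivative_mult_right) auto
  moreover have "dder l (\<lambda>x. u x + c * v x) = (\<lambda>x. dder l u x + c * dder l v x)"
    using Suc l by simp
  ultimately show ?case unfolding dder.simps(2)[of l "\<lambda>x. u x + c * v x"]
    by (intro ext) (simp only: vector_derivative_at)
qed simp

lemma Ck_add_mult:
  assumes "u \<in> Ck k" "v \<in> Ck k"
  shows "(\<lambda>x. u x + c * v x) \<in> Ck k"
proof -
  have "dder l (\<lambda>x. u x + c * v x) differentiable (at x)" if "enat l < k" for l x
    using assms that by (subst dder_add_mult) (auto simp: Ck_def intro!: derivative_intros)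
  moreover have "continuous_on UNIV (dder l (\<lambda>x. u x + c * v x))" if "enat l \<le> k" for l
    using assms that by (subst dder_add_mult) (auto simp: Ck_def intro!: continuous_intros)
  ultimately show ?thesis unfolding Ck_def by blast
qed

text \<open>A basic neighbourhood tests finitely many derivatives on a compact interval, where those
  of \<open>v\<close> are bounded.\<close>

lemma Ck_nbhd_add_small_mult:
  assumes "u \<in> Ck k" "v \<in> Ck k" "e > 0"
  obtains d where "d > 0" "\<And>t. t \<in> {0<..<d} \<Longrightarrow> (\<lambda>x. u x + of_real t * v x) \<in> Ck_nbhd k u N L e"
proof -
  have "\<exists>b. \<forall>x\<in>{-real N..real N}. norm (dder l v x) \<le> b" if "enat l \<le> k" for l
  proof -
    have "continuous_on {-real N..real N} (dder l v)"
      using assms(2) that continuous_on_subset by (fastforce simp: Ck_def)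
    then have "bounded (dder l v ` {-real N..real N})"
      by (intro compact_imp_bounded compact_continuous_image) auto
    then show ?thesis by (simp add: bounded_iff)
  qed
  then obtain b where b: "\<And>l x. enat l \<le> k \<Longrightarrow> x\<in>{-real N..real N} \<Longrightarrow> norm (dder l v x) \<le> b l"
    by metis
  \<comment> \<open>For \<open>l\<close> beyond \<open>k\<close> the number \<open>b l\<close> is
    arbitrary, hence the absolute values; the added 1 makes \<open>B\<close> positive and
    \<open>b l < B\<close> strict.\<close>
  define B where "B = 1 + (\<Sum>l\<le>L. \<bar>b l\<bar>)"
  have B: "B > 0" unfolding B_def by (intro add_pos_nonneg sum_nonneg) auto
  have bB: "b l < B" if "l \<le> L" for l
  proof -
    have "\<bar>b l\<bar> \<le> (\<Sum>l\<le>L. \<bar>b l\<bar>)" using that by (intro member_le_sum) auto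
    then show ?thesis by (simp add: B_def)
  qed
  show thesis
  proof
    show "e / B > 0" using assms(3) B by simp
    fix t assume t: "t \<in> {0<..<e / B}"
    have "norm (dder l (\<lambda>x. u x + of_real t * v x) x - dder l u x) < e"
      if l: "l \<le> L" "enat l \<le> k" and x: "x \<in> {-real N..real N}" for l x
    proof -
      have "norm (dder l (\<lambda>x. u x + of_real t * v x) x - dder l u x) = t * norm (dder l v x)"
        using t by (simp add: dder_add_mult[OF assms(1,2) l(2)] norm_mult)
      also have "\<dots> \<le> t * B" using t b[OF l(2) x] bB[OF l(1)] by (intro mult_left_mono) auto
      also have "\<dots> < e" using t B by (simp add: field_simps)
      finally show ?thesis .
    qed
    then show "(\<lambda>x. u x + of_real t * v x) \<in> Ck_nbhd k u N L e"
      using Ck_add_mult[OF assms(1,2)] by (auto simp: Ck_nbhd_def)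
  qed
qed

text \<open>The function is real valued, so an extension to one side reflects to the other, and the
  two glue to a forbidden holomorphic extension.\<close>

lemma lacunary_no_half_ext:
  assumes "r > 0" "s = 1 \<or> s = -1"
  shows "\<not> half_ext s M (\<lambda>x. of_real (lacunary 0 x)) x0 r"
proof
  assume h: "half_ext s M (\<lambda>x. of_real (lacunary 0 x)) x0 r"
  then have "half_ext (-s) M (\<lambda>x. of_real (lacunary 0 x)) x0 r" by (rule half_ext_reflect) simp
  then have "half_ext 1 M (\<lambda>x. of_real (lacunary 0 x)) x0 r" "half_ext (-1) M (\<lambda>x. of_real (lacunary 0 x)) x0 r"
    using h assms(2) by auto
  from half_ext_both_sides_imp_holomorphic_ext[OF this] lacunary_no_holomorphic_ext[OF assms(1)]
  show False by fastforce
qed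

text \<open>Pigeonhole along the segment \<open>u + t w\<close>: were every small perturbation
  extendable from some side, uncountably many \<open>t\<close> would share countably many half
  disks.\<close>

lemma U4_meets_Ck_nbhd:
  assumes u: "u \<in> Ck k" and e: "e > 0"
  shows "U4 k \<inter> Ck_nbhd k u N L e \<noteq> {}"
proof (rule ccontr)
  assume contra: "\<not> ?thesis"
  define w :: "real \<Rightarrow> complex" where "w x = of_real (lacunary 0 x)" for x
  define v where "v t x = u x + of_real t * w x" for t x
  define sg :: "bool \<Rightarrow> real" where "sg b = (if b then 1 else -1)" for b
  have w: "w \<in> Ck k" using lacunary_in_Ck[of k] by (simp add: w_def[abs_def])
  obtain d where d: "d > 0" "\<And>t. t \<in> {0<..<d} \<Longrightarrow> v t \<in> Ck_nbhd k u N L e"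
    using Ck_nbhd_add_small_mult[OF u w e] unfolding v_def by blast
  \<comment> \<open>The index records side, centre and radius but not the bound: subtraction needs a
    common half disk only.\<close>
  define ext where "ext t = (\<lambda>(b, q, n). \<exists>M. half_ext (sg b) M (v t) (of_rat q) (1 / real (Suc n)))" for t
  have "\<exists>i. ext t i" if "t \<in> {0<..<d}" for t
  proof -
    have "v t \<in> Ck_nbhd k u N L e" using d that by blast
    then have C: "v t \<in> Ck k" and "v t \<notin> U4 k" using contra by (auto simp: Ck_nbhd_def)
    then have "(\<exists>x0 r. r > 0 \<and> one_sided_ext (v t) x0 r (half_disk (sg True) x0 r)) \<or>
       (\<exists>x0 r. r > 0 \<and> one_sided_ext (v t) x0 r (half_disk (sg False) x0 r))"
      by (simp add: U4_def U2_def U3_def half_disk_unit sg_def)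
    then obtain b where "\<exists>x0 r. r > 0 \<and> one_sided_ext (v t) x0 r (half_disk (sg b) x0 r)"
      by (elim disjE) (rule that, assumption)+
    moreover have "sg b \<noteq> 0" by (simp add: sg_def)
    ultimately obtain q n m where "half_ext (sg b) (real m) (v t) (of_rat q) (1 / real (Suc n))"
      using one_sided_ext_iff_rational[OF Ck_imp_continuous[OF C], of "sg b"] by blast
    then show ?thesis by (intro exI[of _ "(b, q, n)"]) (auto simp: ext_def)
  qed
  then obtain i where i: "\<And>t. t \<in> {0<..<d} \<Longrightarrow> ext t (i t)" by metis
  have "\<not> inj_on i {0<..<d}"
    using countable_image_inj_on[of i "{0<..<d}"] uncountable_open_interval[of 0 d] d(1) by auto
  then obtain t t' where t: "t \<in> {0<..<d}" "t' \<in> {0<..<d}" "t \<noteq> t'" "i t = i t'"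
    unfolding inj_on_def by blast
  obtain b q n where bqn: "i t = (b, q, n)" by (cases "i t") auto
  obtain M M' where "half_ext (sg b) M (v t) (of_rat q) (1 / real (Suc n))"
     "half_ext (sg b) M' (v t') (of_rat q) (1 / real (Suc n))"
    using i[OF t(1)] i[OF t(2)] t(4) bqn by (auto simp: ext_def)
  from half_ext_diff[OF this, of "1 / of_real (t - t')"]
  obtain M where "half_ext (sg b) M (\<lambda>x. 1 / of_real (t - t') * (v t x - v t' x)) (of_rat q) (1 / real (Suc n))"
    by blast
  \<comment> \<open>The summand \<open>u\<close> cancels and the difference quotient in
    \<open>t\<close> is exactly \<open>w\<close>.\<close>
  moreover have "(\<lambda>x. 1 / of_real (t - t') * (v t x - v t' x)) = (\<lambda>x. of_real (lacunary 0 x))"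
    using t(3) by (auto simp: v_def w_def field_simps)
  ultimately show False using lacunary_no_half_ext[of "1 / real (Suc n)" "sg b"] by (auto simp: sg_def)
qed

text \<open>\<open>U4 k\<close> lies in all four classes, so its density settles every case.\<close>

lemma dense_if_U4_subset:
  assumes "U4 k \<subseteq> S"
  shows "Ck_top k closure_of S = topspace (Ck_top k)"
proof -
  have "\<exists>y\<in>S. y \<in> T" if "u \<in> Ck k" "u \<in> T" "Ck_open k T" for u T
  proof -
    obtain N L e where "e > 0" "Ck_nbhd k u N L e \<subseteq> T"
      using \<open>u \<in> T\<close> \<open>Ck_open k T\<close> unfolding Ck_open_def by blast
    then show ?thesis using U4_meets_Ck_nbhd[OF \<open>u \<in> Ck k\<close>, of e N L] assms by blast
  qed
  then show ?thesis by (auto simp: closure_of_def topspace_Ck_top openin_Ck_top)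
qed

theorem theorem4p20:
  fixes k :: enat
  shows "dense_gdelta_in (Ck_top k) (U2 k) \<and> dense_gdelta_in (Ck_top k) (U3 k)
       \<and> dense_gdelta_in (Ck_top k) (U4 k) \<and> dense_gdelta_in (Ck_top k) (U5 k)"
proof -
  have "gdelta_in (Ck_top k) (U2 k)" "gdelta_in (Ck_top k) (U3 k)"
    unfolding U2_eq U3_eq by (intro gdelta_in_INT_openin openin_non_ext)+
  moreover from this have "gdelta_in (Ck_top k) (U4 k)"
    unfolding U4_def by (rule gdelta_in_Int)
  moreover have "gdelta_in (Ck_top k) (U5 k)"
    unfolding U5_eq by (intro gdelta_in_INT_openin openin_Un openin_non_ext)
  moreover have "U4 k \<subseteq> U5 k" unfolding U4_def U2_eq U5_eq by blast
  moreover have "U4 k \<subseteq> U2 k" "U4 k \<subseteq> U3 k" by (simp_all add: U4_def)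
  ultimately show ?thesis unfolding dense_gdelta_in_def by (simp add: dense_if_U4_subset)
qed

end
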